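(* Let $(A,d_A)$ be a differential algebra of weight $\lambda$ and let $(V,d_V)$ be a bimodule over $(A,d_A)$. There is a long exact sequence of cohomology groups $$\cdots\to H^{n-1}_{\mathsf{DO}_\lambda}(d_A,d_V)\xrightarrow{\ \bar\iota\ }H^n_{\mathsf{DA}_\lambda}(A,V)\xrightarrow{\ \bar\pi\ }HH^n_{\mathsf{Alg}}(A,V)\xrightarrow{(-1)^n\bar\delta}H^n_{\mathsf{DO}_\lambda}(d_A,d_V)\to\cdots,$$ where $\bar\iota$ and $\bar\pi$ are induced by the inclusion $\iota:g\mapsto(0,g)$ and the projection $\pi:(f,g)\mapsto f$ (in degree $0$, $\pi$ is the identity of $V$), and $\bar\delta:HH^n_{\mathsf{Alg}}(A,V)\to H^n_{\mathsf{DO}_\lambda}(d_A,d_V)$ is given by $\bar\delta[f]=[\delta f]$, with $[\,\cdot\,]$ denoting cohomology classes.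
   Context: Throughout, $\mathbf{k}$ is a field of characteristic zero; all vector spaces, algebras, linear maps and tensor products are over $\mathbf{k}$. Fix $\lambda\in\mathbf{k}$. A differential algebra of weight $\lambda$ is an associative algebra $A$ with a linear operator $d_A:A\to A$ such that $d_A(xy)=d_A(x)y+xd_A(y)+\lambda d_A(x)d_A(y)$ for all $x,y\in A$; if $A$ is unital one further requires $d_A(1_A)=0$. A bimodule over $(A,d_A)$ is a bimodule $V$ over the associative algebra $A$ (left action $xv$, right action $vx$) with $d_V\in\mathrm{End}_{\mathbf{k}}(V)$ such that $d_V(xv)=d_A(x)v+xd_V(v)+\lambda d_A(x)d_V(v)$ and $d_V(vx)=vd_A(x)+d_V(v)x+\lambda d_V(v)d_A(x)$ for all $x\in A,v\in V$. The formulas $x\vdash_\lambda v=(x+\lambda d_A(x))v$, $v\dashv_\lambda x=v(x+\lambda d_A(x))$ define another bimodule structure on $(V,d_V)$ over $(A,d_A)$. Set $C^n_{\mathsf{Alg}}(A,V)=C^n_{\mathsf{DO}_\lambda}(d_A,d_V)=\mathrm{Hom}(A^{\otimes n},V)$ for $n\ge0$ (equal to $V$ for $n=0$), and $0$ for $n<0$. The operator $\partial:C^n_{\mathsf{Alg}}(A,V)\to C^{n+1}_{\mathsf{Alg}}(A,V)$ is the Hochschild coboundary $$\partial f(x_1,\dots,x_{n+1})=x_1f(x_2,\dots,x_{n+1})+\sum_{i=1}^n(-1)^if(x_1,\dots,x_ix_{i+1},\dots,x_{n+1})+(-1)^{n+1}f(x_1,\dots,x_n)x_{n+1},$$ and $\partial_\lambda:C^n_{\mathsf{DO}_\lambda}(d_A,d_V)\to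 C^{n+1}_{\mathsf{DO}_\lambda}(d_A,d_V)$ is $$\partial_\lambda f(x_1,\dots,x_{n+1})=x_1\vdash_\lambda f(x_2,\dots,x_{n+1})+\sum_{i=1}^n(-1)^if(x_1,\dots,x_ix_{i+1},\dots,x_{n+1})+(-1)^{n+1}f(x_1,\dots,x_n)\dashv_\lambda x_{n+1}.$$ The linear map $\delta:C^n_{\mathsf{Alg}}(A,V)\to C^n_{\mathsf{DO}_\lambda}(d_A,d_V)$ is defined for $n\ge1$ by $$\delta f(x_1,\dots,x_n)=\sum_{k=1}^n\lambda^{k-1}\sum_{1\le i_1<\cdots<i_k\le n}f(x_1,\dots,d_A(x_{i_1}),\dots,d_A(x_{i_k}),\dots,x_n)-d_V(f(x_1,\dots,x_n)),$$ and for $n=0$ by $\delta v=-d_V(v)$. The complex $(C^*_{\mathsf{DA}_\lambda}(A,V),\partial_{\mathsf{DA}_\lambda})$ is given by $C^0_{\mathsf{DA}_\lambda}(A,V)=V$ and $C^n_{\mathsf{DA}_\lambda}(A,V)=C^n_{\mathsf{Alg}}(A,V)\oplus C^{n-1}_{\mathsf{DO}_\lambda}(d_A,d_V)$ for $n\ge1$, with $\partial_{\mathsf{DA}_\lambda}(f,g)=(\partial f,\ \partial_\lambda g+(-1)^n\delta f)$ for $f\in C^n_{\mathsf{Alg}}(A,V)$, $g\in C^{n-1}_{\mathsf{DO}_\lambda}(d_A,d_V)$, $n\ge1$, and $\partial_{\mathsf{DA}_\lambda}v=(\partial v,\delta v)$ for $v\in V$. $HH^*_{\mathsf{Alg}}(A,V)$,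 $H^*_{\mathsf{DO}_\lambda}(d_A,d_V)$ and $H^*_{\mathsf{DA}_\lambda}(A,V)$ denote the cohomologies of $(C^*_{\mathsf{Alg}}(A,V),\partial)$, $(C^*_{\mathsf{DO}_\lambda}(d_A,d_V),\partial_\lambda)$ and $(C^*_{\mathsf{DA}_\lambda}(A,V),\partial_{\mathsf{DA}_\lambda})$ respectively. *)

theory Defs
  imports Complex_Main "HOL-Algebra.Coset" "HOL-Library.Function_Algebras"
    "HOL-Library.Product_Plus"
begin

section \<open>Differential algebras of weight \<open>lam\<close> and their bimodules\<close>

text \<open>
  The underlying associative algebra is not assumed to be unital (class \<open>ring\<close>); the last
  assumption applies only if a two-sided unit happens to exist.
\<close>

locale differential_algebra = vector_space scaleA
  for scaleA :: "'k::field_char_0 \<Rightarrow> 'a::ring \<Rightarrow> 'a" +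
  fixes lam :: 'k and dA :: "'a \<Rightarrow> 'a"
  assumes scale_mult_left: "scaleA c x * y = scaleA c (x * y)"
    and scale_mult_right: "x * scaleA c y = scaleA c (x * y)"
    and dA_linear: "Vector_Spaces.linear scaleA scaleA dA"
    and dA_mult: "dA (x * y) = dA x * y + x * dA y + scaleA lam (dA x * dA y)"
    and dA_unit: "(\<And>x. e * x = x \<and> x * e = x) \<Longrightarrow> dA e = 0"

text \<open>\<open>lact x v\<close> is the left action \<open>x v\<close> and \<open>ract v x\<close> is the right action \<open>v x\<close>.\<close>

locale differential_bimodule =
  differential_algebra scaleA lam dA + V: vector_space scaleV
  for scaleA :: "'k::field_char_0 \<Rightarrow> 'a::ring \<Rightarrow> 'a" and lam :: 'k and dA :: "'a \<Rightarrow> 'a"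
    and scaleV :: "'k \<Rightarrow> 'v::ab_group_add \<Rightarrow> 'v" +
  fixes lact :: "'a \<Rightarrow> 'v \<Rightarrow> 'v" and ract :: "'v \<Rightarrow> 'a \<Rightarrow> 'v" and dV :: "'v \<Rightarrow> 'v"
  assumes lact_linear_left: "Vector_Spaces.linear scaleA scaleV (\<lambda>x. lact x v)"
    and lact_linear_right: "Vector_Spaces.linear scaleV scaleV (\<lambda>v. lact x v)"
    and ract_linear_left: "Vector_Spaces.linear scaleV scaleV (\<lambda>v. ract v x)"
    and ract_linear_right: "Vector_Spaces.linear scaleA scaleV (\<lambda>x. ract v x)"
    and lact_mult: "lact (x * y) v = lact x (lact y v)"
    and ract_mult: "ract v (x * y) = ract (ract v x) y"
    and lact_ract: "ract (lact x v) y = lact x (ract v y)"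
    and dV_linear: "Vector_Spaces.linear scaleV scaleV dV"
    and dV_lact: "dV (lact x v) = lact (dA x) v + lact x (dV v) + scaleV lam (lact (dA x) (dV v))"
    and dV_ract: "dV (ract v x) = ract v (dA x) + ract (dV v) x + scaleV lam (ract (dV v) (dA x))"

definition vdash :: "('k \<Rightarrow> 'a::ring \<Rightarrow> 'a) \<Rightarrow> 'k \<Rightarrow> ('a \<Rightarrow> 'a) \<Rightarrow> ('a \<Rightarrow> 'v \<Rightarrow> 'v) \<Rightarrow> 'a \<Rightarrow> 'v \<Rightarrow> 'v"
  where "vdash scaleA lam dA lact x v = lact (x + scaleA lam (dA x)) v"

definition dashv :: "('k \<Rightarrow> 'a::ring \<Rightarrow> 'a) \<Rightarrow> 'k \<Rightarrow> ('a \<Rightarrow> 'a) \<Rightarrow> ('v \<Rightarrow> 'a \<Rightarrow> 'v) \<Rightarrow> 'v \<Rightarrow> 'a \<Rightarrow> 'v"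
  where "dashv scaleA lam dA ract v x = ract v (x + scaleA lam (dA x))"


section \<open>Cohomology of cochain complexes of vector spaces\<close>

text \<open>
  A complex is indexed by the integers. Its cochain spaces are subsets of one ambient abelian
  group, and \<open>codiff K n\<close> is the differential out of degree \<open>n\<close>.
\<close>

record ('k, 'c) cochain_complex =
  cscale :: "'k \<Rightarrow> 'c \<Rightarrow> 'c"
  cochain :: "int \<Rightarrow> 'c set"
  codiff :: "int \<Rightarrow> 'c \<Rightarrow> 'c"

definition cocycles :: "('k, 'c::ab_group_add) cochain_complex \<Rightarrow> int \<Rightarrow> 'c set"
  where "cocycles K n = {z \<in> cochain K n. codiff K n z = 0}"

definition coboundaries :: "('k, 'c::ab_group_add) cochain_complex \<Rightarrow> int \<Rightarrow> 'c set"
  where "coboundaries K n = codiff K (n - 1) ` cochain K (n - 1)"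

definition cocycle_group :: "('k, 'c::ab_group_add) cochain_complex \<Rightarrow> int \<Rightarrow> 'c monoid"
  where "cocycle_group K n = \<lparr>carrier = cocycles K n, monoid.mult = (+), one = 0\<rparr>"

definition cohomology :: "('k, 'c::ab_group_add) cochain_complex \<Rightarrow> int \<Rightarrow> 'c set monoid"
  where "cohomology K n = cocycle_group K n Mod coboundaries K n"

definition coh_class :: "('k, 'c::ab_group_add) cochain_complex \<Rightarrow> int \<Rightarrow> 'c \<Rightarrow> 'c set"
  where "coh_class K n z = coboundaries K n #>\<^bsub>cocycle_group K n\<^esub> z"

text \<open>
  \<open>induced L m h\<close> sends a cohomology class \<open>X\<close> to the common class, in degree \<open>m\<close> of \<open>L\<close>, of
  all \<open>h z\<close> with \<open>z\<close> in \<open>X\<close>. The value is meaningful only if these classes agree.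
\<close>

definition induced :: "('k, 'd::ab_group_add) cochain_complex \<Rightarrow> int \<Rightarrow> ('c \<Rightarrow> 'd) \<Rightarrow> 'c set \<Rightarrow> 'd set"
  where "induced L m h X = the_elem ((\<lambda>z. coh_class L m (h z)) ` X)"

definition coh_scale :: "('k, 'c::ab_group_add) cochain_complex \<Rightarrow> int \<Rightarrow> 'k \<Rightarrow> 'c set \<Rightarrow> 'c set"
  where "coh_scale K n c = induced K n (cscale K c)"

definition coh_linear :: "('k, 'c::ab_group_add) cochain_complex \<Rightarrow> int \<Rightarrow>
    ('k, 'd::ab_group_add) cochain_complex \<Rightarrow> int \<Rightarrow> ('c set \<Rightarrow> 'd set) \<Rightarrow> bool"
  where "coh_linear K n L m h \<longleftrightarrow>
    group_hom (cohomology K n) (cohomology L m) h \<and>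
    (\<forall>c. \<forall>X \<in> carrier (cohomology K n). h (coh_scale K n c X) = coh_scale L m c (h X))"


section \<open>The three complexes\<close>

text \<open>
  \<open>Hom(A\<^sup>\<otimes>\<^sup>n, V)\<close> is the space of \<open>n\<close>-linear maps, encoded as functions on lists that vanish on
  all lists of length different from \<open>n\<close>. It is the zero space for \<open>n < 0\<close>, and it is \<open>V\<close>
  for \<open>n = 0\<close> via \<open>f \<mapsto> f []\<close>.
\<close>

definition multilinear_maps :: "('k::field \<Rightarrow> 'a::ab_group_add \<Rightarrow> 'a) \<Rightarrow>
    ('k \<Rightarrow> 'v::ab_group_add \<Rightarrow> 'v) \<Rightarrow> int \<Rightarrow> ('a list \<Rightarrow> 'v) set"
  where "multilinear_maps scaleA scaleV n =
    {f. (\<forall>xs. int (length xs) \<noteq> n \<longrightarrow> f xs = 0) \<and>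
        (\<forall>xs ys. Vector_Spaces.linear scaleA scaleV (\<lambda>x. f (xs @ x # ys)))}"

definition fun_scale :: "('k \<Rightarrow> 'v \<Rightarrow> 'v) \<Rightarrow> 'k \<Rightarrow> ('a list \<Rightarrow> 'v) \<Rightarrow> 'a list \<Rightarrow> 'v"
  where "fun_scale scaleV c f = (\<lambda>xs. scaleV c (f xs))"

text \<open>\<open>contract i [x\<^sub>1, \<dots>, x\<^sub>m] = [x\<^sub>1, \<dots>, x\<^sub>i x\<^sub>i\<^sub>+\<^sub>1, \<dots>, x\<^sub>m]\<close> for \<open>1 \<le> i < m\<close>.\<close>

definition contract :: "nat \<Rightarrow> 'a::times list \<Rightarrow> 'a list"
  where "contract i xs = take (i - 1) xs @ (xs ! (i - 1) * xs ! i) # drop (i + 1) xs"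

definition signed :: "nat \<Rightarrow> 'v::ab_group_add \<Rightarrow> 'v"
  where "signed i v = (if even i then v else - v)"

text \<open>
  The Hochschild coboundary for the left action \<open>l\<close> and the right action \<open>r\<close>. On cochains of
  degree \<open>n\<close> only lists with \<open>n + 1\<close> entries matter, so \<open>n\<close> is read off from the argument.
\<close>

definition hochschild :: "('a::ring \<Rightarrow> 'v::ab_group_add \<Rightarrow> 'v) \<Rightarrow> ('v \<Rightarrow> 'a \<Rightarrow> 'v) \<Rightarrow>
    ('a list \<Rightarrow> 'v) \<Rightarrow> 'a list \<Rightarrow> 'v"
  where "hochschild l r f xs =
    (if xs = [] then 0
     else let n = length xs - 1 in
       l (hd xs) (f (tl xs))
       + (\<Sum>i=1..n. signed i (f (contract i xs)))
       + signed (n + 1) (r (f (butlast xs)) (last xs)))"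

text \<open>
  The increasing sequences \<open>i\<^sub>1 < \<dots> < i\<^sub>k\<close> are encoded by the \<open>k\<close>-element sets \<open>I\<close> of positions,
  counted from 0. For the empty list the sum is empty, which gives \<open>- dV v\<close> in degree 0.
\<close>

definition delta_map :: "('k::field \<Rightarrow> 'v::ab_group_add \<Rightarrow> 'v) \<Rightarrow> 'k \<Rightarrow> ('a \<Rightarrow> 'a) \<Rightarrow> ('v \<Rightarrow> 'v) \<Rightarrow>
    ('a list \<Rightarrow> 'v) \<Rightarrow> 'a list \<Rightarrow> 'v"
  where "delta_map scaleV lam dA dV f xs =
    (\<Sum>k=1..length xs. scaleV (lam ^ (k - 1))
      (\<Sum>I \<in> {I. I \<subseteq> {..<length xs} \<and> card I = k}.
         f (map (\<lambda>i. if i \<in> I then dA (xs ! i) else xs ! i) [0..<length xs])))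
    - dV (f xs)"

definition C_Alg :: "('k::field \<Rightarrow> 'a::ring \<Rightarrow> 'a) \<Rightarrow> ('k \<Rightarrow> 'v::ab_group_add \<Rightarrow> 'v) \<Rightarrow>
    ('a \<Rightarrow> 'v \<Rightarrow> 'v) \<Rightarrow> ('v \<Rightarrow> 'a \<Rightarrow> 'v) \<Rightarrow> ('k, 'a list \<Rightarrow> 'v) cochain_complex"
  where "C_Alg scaleA scaleV lact ract =
    \<lparr>cscale = fun_scale scaleV,
     cochain = multilinear_maps scaleA scaleV,
     codiff = (\<lambda>n. hochschild lact ract)\<rparr>"

definition C_DO :: "('k::field \<Rightarrow> 'a::ring \<Rightarrow> 'a) \<Rightarrow> 'k \<Rightarrow> ('a \<Rightarrow> 'a) \<Rightarrow>
    ('k \<Rightarrow> 'v::ab_group_add \<Rightarrow> 'v) \<Rightarrow> ('a \<Rightarrow> 'v \<Rightarrow> 'v) \<Rightarrow> ('v \<Rightarrow> 'a \<Rightarrow> 'v) \<Rightarrow>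
    ('k, 'a list \<Rightarrow> 'v) cochain_complex"
  where "C_DO scaleA lam dA scaleV lact ract =
    C_Alg scaleA scaleV (vdash scaleA lam dA lact) (dashv scaleA lam dA ract)"

text \<open>
  Since \<open>C_DO\<close> vanishes in degree \<open>-1\<close>, the degree 0 part of \<open>C_DA\<close> is \<open>V \<oplus> 0\<close>, which is
  identified with \<open>V\<close>; under this identification the projection \<open>fst\<close> is the identity of \<open>V\<close>
  and the formula for the differential also covers degree 0.
\<close>

definition C_DA :: "('k::field \<Rightarrow> 'a::ring \<Rightarrow> 'a) \<Rightarrow> 'k \<Rightarrow> ('a \<Rightarrow> 'a) \<Rightarrow>
    ('k \<Rightarrow> 'v::ab_group_add \<Rightarrow> 'v) \<Rightarrow> ('a \<Rightarrow> 'v \<Rightarrow> 'v) \<Rightarrow> ('v \<Rightarrow> 'a \<Rightarrow> 'v) \<Rightarrow> ('v \<Rightarrow> 'v) \<Rightarrow>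
    ('k, ('a list \<Rightarrow> 'v) \<times> ('a list \<Rightarrow> 'v)) cochain_complex"
  where "C_DA scaleA lam dA scaleV lact ract dV =
    (let A = C_Alg scaleA scaleV lact ract; D = C_DO scaleA lam dA scaleV lact ract in
    \<lparr>cscale = (\<lambda>c (f, g). (cscale A c f, cscale D c g)),
     cochain = (\<lambda>n. cochain A n \<times> cochain D (n - 1)),
     codiff = (\<lambda>n (f, g). (codiff A n f,
       codiff D (n - 1) g + cscale D ((- 1) powi n) (delta_map scaleV lam dA dV f)))\<rparr>)"

end

theory Submission
  imports Defs
begin

text \<open>
  The complex of the differential algebra is a mapping cone of \<open>\<delta>\<close>, so the long exact sequence is
  the standard one once \<open>\<delta>\<close> is known to be a cochain map. For that, put \<open>e x = x + \<lambda> d x\<close>. Then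
  \<open>e\<close> is multiplicative, \<open>d (x y) = d x y + e x d y\<close>, and the sum over nonempty sets of positions
  telescopes: on multilinear \<open>f\<close> it equals
  \<open>P f (x\<^sub>1, \<dots>, x\<^sub>n) = \<Sum>\<^sub>j f (e x\<^sub>1, \<dots>, e x\<^sub>j\<^sub>-\<^sub>1, d x\<^sub>j, x\<^sub>j\<^sub>+\<^sub>1, \<dots>, x\<^sub>n)\<close>, with
  \<open>f (e x\<^sub>1, \<dots>, e x\<^sub>n) = f (x\<^sub>1, \<dots>, x\<^sub>n) + \<lambda> P f (x\<^sub>1, \<dots>, x\<^sub>n)\<close>. In this form \<open>\<delta> f = P f - d\<^sub>V \<circ> f\<close>
  commutes with each of the faces whose alternating sum is the Hochschild coboundary.
\<close>

section \<open>The long exact sequence of a mapping cone\<close>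

locale cochain_cx = vector_space "cscale K"
  for K :: "('k::field, 'c::ab_group_add) cochain_complex" +
  assumes subspace_cochain: "subspace (cochain K n)"
    and codiff_in: "x \<in> cochain K n \<Longrightarrow> codiff K n x \<in> cochain K (n + 1)"
    and codiff_add: "x \<in> cochain K n \<Longrightarrow> y \<in> cochain K n \<Longrightarrow>
      codiff K n (x + y) = codiff K n x + codiff K n y"
    and codiff_scale: "x \<in> cochain K n \<Longrightarrow> codiff K n (cscale K c x) = cscale K c (codiff K n x)"
    and codiff_codiff: "x \<in> cochain K n \<Longrightarrow> codiff K (n + 1) (codiff K n x) = 0"
begin

lemmas cochain_zero = subspace_0[OF subspace_cochain]
  and cochain_add = subspace_add[OF subspace_cochain]
  and cochain_scale = subspace_scale[OF subspace_cochain]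
  and cochain_neg = subspace_neg[OF subspace_cochain]

lemma codiff_zero [simp]: "codiff K n 0 = 0"
  using codiff_scale[OF cochain_zero, of n 0] by simp

lemma codiff_neg: "x \<in> cochain K n \<Longrightarrow> codiff K n (- x) = - codiff K n x"
  using codiff_scale[of x n "- 1"] by simp

lemma subspace_cocycles: "subspace (cocycles K n)"
  unfolding subspace_def
  by (auto simp: cocycles_def cochain_zero cochain_add cochain_scale codiff_add codiff_scale)

lemma subspace_coboundaries: "subspace (coboundaries K n)"
  unfolding subspace_def coboundaries_def
proof (intro conjI ballI allI)
  show "0 \<in> codiff K (n - 1) ` cochain K (n - 1)"
    using cochain_zero[of "n - 1"] codiff_zero[of "n - 1"] by (metis imageI)
qed (auto simp: cochain_add cochain_scale simp flip: codiff_add codiff_scale)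

lemmas cocycles_add = subspace_add[OF subspace_cocycles]
  and cocycles_zero = subspace_0[OF subspace_cocycles]
  and cocycles_scale = subspace_scale[OF subspace_cocycles]
  and cocycles_neg = subspace_neg[OF subspace_cocycles]
  and cocycles_diff = subspace_diff[OF subspace_cocycles]
  and coboundaries_add = subspace_add[OF subspace_coboundaries]
  and coboundaries_zero = subspace_0[OF subspace_coboundaries]
  and coboundaries_scale = subspace_scale[OF subspace_coboundaries]
  and coboundaries_neg = subspace_neg[OF subspace_coboundaries]
  and coboundaries_diff = subspace_diff[OF subspace_coboundaries]

lemma coboundaries_subset: "coboundaries K n \<subseteq> cocycles K n"
  using codiff_in[of _ "n - 1"] codiff_codiff[of _ "n - 1"]
  by (auto simp: coboundaries_def cocycles_def)

lemma comm_group_cocycle_group: "comm_group (cocycle_group K n)"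
proof (rule comm_groupI)
  fix x assume "x \<in> carrier (cocycle_group K n)"
  then show "\<exists>y\<in>carrier (cocycle_group K n). y \<otimes>\<^bsub>cocycle_group K n\<^esub> x = \<one>\<^bsub>cocycle_group K n\<^esub>"
    by (intro bexI[of _ "- x"]) (auto simp: cocycle_group_def cocycles_neg)
qed (auto simp: cocycle_group_def cocycles_add cocycles_zero ac_simps)

lemma inv_cocycle_group:
  assumes "x \<in> cocycles K n"
  shows "inv\<^bsub>cocycle_group K n\<^esub> x = - x"
proof -
  interpret comm_group "cocycle_group K n" by (rule comm_group_cocycle_group)
  show ?thesis
    using assms by (intro inv_equality) (auto simp: cocycle_group_def cocycles_neg)
qed

text \<open>Every subgroup of an abelian group is normal. This is what makes the quotient
  \<open>Mod\<close> in \<open>cohomology\<close> a group with the expected product of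
  classes.\<close>

lemma coboundaries_normal: "coboundaries K n \<lhd> cocycle_group K n"
proof -
  interpret comm_group "cocycle_group K n" by (rule comm_group_cocycle_group)
  have "subgroup (coboundaries K n) (cocycle_group K n)"
  proof
    fix x assume "x \<in> coboundaries K n"
    then show "inv\<^bsub>cocycle_group K n\<^esub> x \<in> coboundaries K n"
      using coboundaries_subset[of n]
      by (subst inv_cocycle_group) (auto intro: coboundaries_neg)
  qed (use coboundaries_subset in \<open>auto simp: cocycle_group_def coboundaries_add coboundaries_zero\<close>)
  then show ?thesis by (simp add: normal_iff_subgroup)
qed

lemma group_cohomology: "group (cohomology K n)"
  unfolding cohomology_def by (rule normal.factorgroup_is_group[OF coboundaries_normal])

lemma coh_class_eq_image: "coh_class K n z = (\<lambda>b. b + z) ` coboundaries K n"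
  by (auto simp: coh_class_def r_coset_def cocycle_group_def)

lemma coh_class_zero: "coh_class K n 0 = coboundaries K n"
  by (simp add: coh_class_eq_image)

lemma mem_coh_class_iff: "w \<in> coh_class K n z \<longleftrightarrow> w - z \<in> coboundaries K n"
  by (force simp: coh_class_eq_image image_iff algebra_simps)

text \<open>Cosets of a subgroup agree exactly when representatives differ by an element of it; the
  exactness proofs use this to turn equations between classes into equations between
  cochains.\<close>

lemma coh_class_eq_iff: "coh_class K n z = coh_class K n w \<longleftrightarrow> z - w \<in> coboundaries K n"
proof
  assume "coh_class K n z = coh_class K n w"
  then show "z - w \<in> coboundaries K n"
    using mem_coh_class_iff[of z n z] mem_coh_class_iff[of z n w] coboundaries_zero by simp
next
  assume *: "z - w \<in> coboundaries K n"
  have "v - z \<in> coboundaries K n \<longleftrightarrow> v - w \<in> coboundaries K n" for v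
    using coboundaries_add[OF _ *, of "v - z"] coboundaries_diff[OF _ *, of "v - w"] by auto
  then show "coh_class K n z = coh_class K n w"
    by (auto simp: mem_coh_class_iff)
qed

lemma carrier_cohomology: "carrier (cohomology K n) = coh_class K n ` cocycles K n"
  by (auto simp: cohomology_def coh_class_def FactGroup_def RCOSETS_def cocycle_group_def)

lemma one_cohomology: "\<one>\<^bsub>cohomology K n\<^esub> = coh_class K n 0"
  by (simp add: cohomology_def coh_class_zero)

lemma mult_cohomology:
  assumes "z \<in> cocycles K n" "w \<in> cocycles K n"
  shows "coh_class K n z \<otimes>\<^bsub>cohomology K n\<^esub> coh_class K n w = coh_class K n (z + w)"
  using normal.rcos_sum[OF coboundaries_normal, of z n w] assms
  by (simp add: cohomology_def coh_class_def cocycle_group_def)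

end

section \<open>Linear maps between cohomology groups\<close>

locale coh_map = K: cochain_cx K + L: cochain_cx L
  for K :: "('k::field, 'c::ab_group_add) cochain_complex" and n :: int
    and L :: "('k, 'd::ab_group_add) cochain_complex" and m :: int and h :: "'c \<Rightarrow> 'd" +
  assumes map_cocycles: "z \<in> cocycles K n \<Longrightarrow> h z \<in> cocycles L m"
    and map_coboundaries: "z \<in> coboundaries K n \<Longrightarrow> h z \<in> coboundaries L m"
    and map_add: "z \<in> cocycles K n \<Longrightarrow> w \<in> cocycles K n \<Longrightarrow> h (z + w) = h z + h w"
    and map_scale: "z \<in> cocycles K n \<Longrightarrow> h (cscale K c z) = cscale L c (h z)"
begin

text \<open>Representatives of a class differ by coboundaries, and \<open>h\<close> sends these to
  coboundaries. So the set under \<open>the_elem\<close> in \<open>induced\<close> is a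
  singleton.\<close>

lemma induced_coh_class:
  assumes z: "z \<in> cocycles K n"
  shows "induced L m h (coh_class K n z) = coh_class L m (h z)"
proof -
  have "coh_class L m (h (b + z)) = coh_class L m (h z)" if "b \<in> coboundaries K n" for b
    using that z K.coboundaries_subset[of n]
    by (auto simp: L.coh_class_eq_iff map_add map_coboundaries)
  then have "(\<lambda>w. coh_class L m (h w)) ` coh_class K n z = {coh_class L m (h z)}"
    using K.coboundaries_zero[of n] by (auto simp: K.coh_class_eq_image image_iff)
  then show ?thesis by (simp add: induced_def)
qed

end

text \<open>Since \<open>coh_scale\<close> is defined through \<open>induced\<close>, this makes
  scalar multiplication of classes computable on representatives.\<close>

lemma (in cochain_cx) coh_map_scale: "coh_map K n K n (cscale K c)"
proof
  fix z assume "z \<in> coboundaries K n"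
  then show "cscale K c z \<in> coboundaries K n" by (rule coboundaries_scale)
qed (auto simp: cocycles_scale scale_right_distrib scale_left_commute)

lemma (in cochain_cx) coh_scale_coh_class:
  "z \<in> cocycles K n \<Longrightarrow> coh_scale K n c (coh_class K n z) = coh_class K n (cscale K c z)"
  unfolding coh_scale_def by (rule coh_map.induced_coh_class[OF coh_map_scale])

text \<open>Only the values of \<open>H\<close> on classes matter. Keeping \<open>H\<close> apart
  from \<open>induced L m h\<close> lets the rule cover the connecting map, which is a composite of
  \<open>coh_scale\<close> and \<open>induced\<close>.\<close>

lemma (in coh_map) coh_linearI:
  assumes "\<And>z. z \<in> cocycles K n \<Longrightarrow> H (coh_class K n z) = coh_class L m (h z)"
  shows "coh_linear K n L m H"
proof -
  have "H \<in> hom (cohomology K n) (cohomology L m)"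
    by (auto simp: hom_def K.carrier_cohomology L.carrier_cohomology assms map_cocycles
        K.mult_cohomology L.mult_cohomology K.cocycles_add map_add)
  then show ?thesis
    unfolding coh_linear_def group_hom_def group_hom_axioms_def
    by (auto simp: K.group_cohomology L.group_cohomology K.carrier_cohomology
        K.coh_scale_coh_class L.coh_scale_coh_class assms map_cocycles K.cocycles_scale map_scale)
qed

section \<open>The cone of a cochain map and its three exactness statements\<close>

definition mapping_cone :: "('k::field, 'c::ab_group_add) cochain_complex \<Rightarrow>
    ('k, 'd::ab_group_add) cochain_complex \<Rightarrow> ('c \<Rightarrow> 'd) \<Rightarrow> ('k, 'c \<times> 'd) cochain_complex"
  where "mapping_cone A D delta =
    \<lparr>cscale = (\<lambda>c (f, g). (cscale A c f, cscale D c g)),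
     cochain = (\<lambda>n. cochain A n \<times> cochain D (n - 1)),
     codiff = (\<lambda>n (f, g). (codiff A n f, codiff D (n - 1) g + cscale D ((- 1) powi n) (delta f)))\<rparr>"

locale cochain_map = A: cochain_cx A + D: cochain_cx D
  for A :: "('k::field, 'c::ab_group_add) cochain_complex"
    and D :: "('k, 'd::ab_group_add) cochain_complex" and delta :: "'c \<Rightarrow> 'd" +
  assumes delta_in: "x \<in> cochain A n \<Longrightarrow> delta x \<in> cochain D n"
    and delta_add: "x \<in> cochain A n \<Longrightarrow> y \<in> cochain A n \<Longrightarrow> delta (x + y) = delta x + delta y"
    and delta_scale: "x \<in> cochain A n \<Longrightarrow> delta (cscale A c x) = cscale D c (delta x)"
    and delta_codiff: "x \<in> cochain A n \<Longrightarrow> delta (codiff A n x) = codiff D n (delta x)"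
begin

abbreviation "T \<equiv> mapping_cone A D delta"

lemma cscale_cone [simp]: "cscale T c (f, g) = (cscale A c f, cscale D c g)"
  by (simp add: mapping_cone_def)

lemma cochain_cone [simp]: "cochain T n = cochain A n \<times> cochain D (n - 1)"
  by (simp add: mapping_cone_def)

lemma codiff_cone [simp]:
  "codiff T n (f, g) = (codiff A n f, codiff D (n - 1) g + cscale D ((- 1) powi n) (delta f))"
  by (simp add: mapping_cone_def)

lemma delta_zero [simp]: "delta 0 = 0"
  using delta_add[OF A.cochain_zero A.cochain_zero] by simp

lemma cone_cochain_cx: "cochain_cx T"
proof -
  have "vector_space (cscale T)"
    by standard (auto simp: A.scale_right_distrib D.scale_right_distrib
        A.scale_left_distrib D.scale_left_distrib)
  then interpret T: vector_space "cscale T" .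
  show ?thesis
  proof
    show "T.subspace (cochain T n)" for n
      unfolding T.subspace_def
      by (auto simp: zero_prod_def A.cochain_zero D.cochain_zero A.cochain_add D.cochain_add
          A.cochain_scale D.cochain_scale)
  next
    fix x n assume "x \<in> cochain T n"
    then obtain f g where x: "x = (f, g)" "f \<in> cochain A n" "g \<in> cochain D (n - 1)" by auto
    show "codiff T n x \<in> cochain T (n + 1)"
      using x D.codiff_in[of g "n - 1"]
      by (auto simp: A.codiff_in delta_in intro!: D.cochain_add D.cochain_scale)
    show "codiff T n (cscale T c x) = cscale T c (codiff T n x)" for c
      using x by (simp add: A.codiff_scale D.codiff_scale delta_scale D.scale_right_distrib mult.commute)
    \<comment> \<open>In the second component \<open>delta f\<close> contributes its coboundary with
      sign \<open>(-1)^n\<close>, and \<open>codiff A n f\<close> contributes the same term with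
      sign \<open>(-1)^(n+1)\<close> because \<open>delta\<close> is a cochain map.\<close>
    show "codiff T (n + 1) (codiff T n x) = 0"
      using x D.codiff_in[of g "n - 1"] D.codiff_codiff[of g "n - 1"]
      by (simp add: A.codiff_codiff delta_codiff delta_in D.codiff_add D.cochain_scale
          D.codiff_scale power_int_add zero_prod_def)
    fix y assume "y \<in> cochain T n"
    then obtain f' g' where y: "y = (f', g')" "f' \<in> cochain A n" "g' \<in> cochain D (n - 1)" by auto
    show "codiff T n (x + y) = codiff T n x + codiff T n y"
      using x y by (simp add: A.codiff_add D.codiff_add delta_add D.scale_right_distrib)
  qed
qed

sublocale T: cochain_cx T
  by (rule cone_cochain_cx)

lemma coh_map_inclusion: "coh_map D (n - 1) T n (\<lambda>g. (0, g))"
proof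
  show "(0, z) \<in> coboundaries T n" if "z \<in> coboundaries D (n - 1)" for z
  proof -
    from that obtain y where y: "y \<in> cochain D (n - 1 - 1)" "z = codiff D (n - 1 - 1) y"
      by (auto simp: coboundaries_def)
    \<comment> \<open>The second component of a cone cochain of degree \<open>n - 1\<close> has
      degree \<open>n - 2\<close>, which is where \<open>y\<close> lives.\<close>
    have "codiff T (n - 1) (0, y) = (0, z)"
      using y by simp
    then show ?thesis
      using y A.cochain_zero[of "n - 1"] unfolding coboundaries_def
      by (intro image_eqI[of _ _ "(0, y)"]) auto
  qed
qed (auto simp: cocycles_def A.cochain_zero zero_prod_def)

lemma coh_map_projection: "coh_map T n A n fst"
  by standard (auto simp: cocycles_def coboundaries_def zero_prod_def)

lemma coh_map_delta: "coh_map A n D n delta"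
  by standard (auto simp: cocycles_def coboundaries_def delta_in delta_add delta_scale delta_codiff
      simp flip: delta_codiff[of _ n])

definition connecting :: "int \<Rightarrow> 'c set \<Rightarrow> 'd set"
  where "connecting n X = coh_scale D n ((- 1) powi n) (induced D n delta X)"

lemma connecting_coh_class:
  assumes "f \<in> cocycles A n"
  shows "connecting n (coh_class A n f) = coh_class D n (cscale D ((- 1) powi n) (delta f))"
proof -
  interpret coh_map A n D n delta by (rule coh_map_delta)
  show ?thesis
    using assms by (simp add: connecting_def induced_coh_class D.coh_scale_coh_class map_cocycles)
qed

lemma coh_linear_connecting: "coh_linear A n D n (connecting n)"
proof -
  interpret coh_map A n D n delta by (rule coh_map_delta)
  have "coh_map A n D n (\<lambda>f. cscale D ((- 1) powi n) (delta f))"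
    by standard (auto simp: map_cocycles map_coboundaries map_add map_scale D.cocycles_scale
        D.coboundaries_scale D.scale_right_distrib mult.commute)
  then show ?thesis
    by (rule coh_map.coh_linearI) (rule connecting_coh_class)
qed

text \<open>The image lies in the kernel because \<open>fst (0, g) = 0\<close>. Conversely, if
  \<open>f\<close> is the coboundary of \<open>h\<close>, subtracting the cone coboundary of
  \<open>(h, 0)\<close> from \<open>(f, g)\<close> kills the first component without changing the
  class.\<close>

lemma exact_at_cone:
  "induced T n (\<lambda>g. (0, g)) ` carrier (cohomology D (n - 1)) =
    kernel (cohomology T n) (cohomology A n) (induced A n fst)"
proof -
  interpret i: coh_map D "n - 1" T n "\<lambda>g. (0, g)" by (rule coh_map_inclusion)
  interpret p: coh_map T n A n fst by (rule coh_map_projection)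
  have "coh_class T n (f, g) \<in> induced T n (\<lambda>g. (0, g)) ` carrier (cohomology D (n - 1))"
    if fg: "(f, g) \<in> cocycles T n" and 0: "coh_class A n f = coh_class A n 0" for f g
  proof -
    from 0 obtain h where h: "h \<in> cochain A (n - 1)" "f = codiff A (n - 1) h"
      by (auto simp: A.coh_class_eq_iff coboundaries_def)
    \<comment> \<open>This is the second component left over after that subtraction; the sign
      belongs to degree \<open>n - 1\<close>, the degree of \<open>h\<close>.\<close>
    define g' where "g' = g - cscale D ((- 1) powi (n - 1)) (delta h)"
    have "(f, g) - (0, g') = codiff T (n - 1) (h, 0)"
      using h by (simp add: g'_def)
    then have *: "(f, g) - (0, g') \<in> coboundaries T n"
      using h D.cochain_zero[of "n - 1 - 1"] unfolding coboundaries_def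
      by (intro image_eqI[of _ _ "(h, 0)"]) auto
    then have "(f, g) - ((f, g) - (0, g')) \<in> cocycles T n"
      using T.coboundaries_subset fg by (blast intro: T.cocycles_diff)
    then have "g' \<in> cocycles D (n - 1)"
      by (simp add: cocycles_def zero_prod_def)
    moreover have "coh_class T n (f, g) = coh_class T n (0, g')"
      using * T.coh_class_eq_iff by blast
    ultimately show ?thesis
      unfolding D.carrier_cohomology image_image
      by (intro image_eqI[of _ _ g']) (auto simp: i.induced_coh_class)
  qed
  then show ?thesis
    by (auto simp: kernel_def D.carrier_cohomology T.carrier_cohomology A.one_cohomology
        i.induced_coh_class p.induced_coh_class i.map_cocycles)
qed

text \<open>Extending a cocycle \<open>f\<close> to a cone cocycle \<open>(f, g)\<close> means
  solving \<open>d g = - (-1)^n delta f\<close>, which is possible exactly when the connecting map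
  kills the class of \<open>f\<close>. This explains the witnesses \<open>- g\<close> in both
  directions.\<close>

lemma exact_at_source:
  "induced A n fst ` carrier (cohomology T n) =
    kernel (cohomology A n) (cohomology D n) (connecting n)"
proof -
  interpret p: coh_map T n A n fst by (rule coh_map_projection)
  have ker: "coh_class D n (cscale D ((- 1) powi n) (delta f)) = coh_class D n 0"
    if "(f, g) \<in> cocycles T n" for f g
  proof -
    have "codiff D (n - 1) (- g) = cscale D ((- 1) powi n) (delta f)" "g \<in> cochain D (n - 1)"
      using that by (auto simp: cocycles_def zero_prod_def D.codiff_neg minus_unique)
    then show ?thesis
      unfolding D.coh_class_eq_iff coboundaries_def
      by (intro image_eqI[of _ _ "- g"]) (auto intro: D.cochain_neg)
  qed
  have im: "coh_class A n f \<in> induced A n fst ` carrier (cohomology T n)"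
    if f: "f \<in> cocycles A n"
      and 0: "coh_class D n (cscale D ((- 1) powi n) (delta f)) = coh_class D n 0" for f
  proof -
    from 0 obtain g where g: "g \<in> cochain D (n - 1)"
      "cscale D ((- 1) powi n) (delta f) = codiff D (n - 1) g"
      by (auto simp: D.coh_class_eq_iff coboundaries_def)
    then have "(f, - g) \<in> cocycles T n"
      using f by (auto simp: cocycles_def zero_prod_def D.codiff_neg D.cochain_neg)
    then show ?thesis
      unfolding T.carrier_cohomology image_image
      by (intro image_eqI[of _ _ "(f, - g)"]) (auto simp: p.induced_coh_class)
  qed
  show ?thesis
    using ker im p.map_cocycles
    by (force simp: kernel_def A.carrier_cohomology T.carrier_cohomology D.one_cohomology
        p.induced_coh_class connecting_coh_class)
qed

text \<open>A coboundary of the cone in degree \<open>n + 1\<close> has first component zero exactly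
  when it comes from a pair \<open>(f, h)\<close> with \<open>f\<close> a cocycle. Its second
  component is then \<open>(-1)^n delta f\<close> up to the coboundary of \<open>h\<close>, so it
  represents the connecting image of the class of \<open>f\<close>.\<close>

lemma exact_at_target:
  "connecting n ` carrier (cohomology A n) =
    kernel (cohomology D n) (cohomology T (n + 1)) (induced T (n + 1) (\<lambda>g. (0, g)))"
proof -
  interpret i: coh_map D n T "n + 1" "\<lambda>g. (0, g)"
    using coh_map_inclusion[of "n + 1"] by simp
  interpret d: coh_map A n D n delta by (rule coh_map_delta)
  have ker: "coh_class T (n + 1) (0, cscale D ((- 1) powi n) (delta f)) = coh_class T (n + 1) 0"
    if "f \<in> cocycles A n" for f
    using that unfolding T.coh_class_eq_iff coboundaries_def
    by (intro image_eqI[of _ _ "(f, 0)"])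
      (auto simp: cocycles_def D.cochain_zero zero_prod_def)
  have im: "coh_class D n g \<in> connecting n ` carrier (cohomology A n)"
    if "coh_class T (n + 1) (0, g) = coh_class T (n + 1) 0" for g
  proof -
    from that obtain f h where f: "f \<in> cochain A n" "codiff A n f = 0"
      and h: "h \<in> cochain D (n - 1)" "g = codiff D (n - 1) h + cscale D ((- 1) powi n) (delta f)"
      by (auto simp: T.coh_class_eq_iff coboundaries_def)
    then have "coh_class D n g = connecting n (coh_class A n f)"
      by (simp add: connecting_coh_class cocycles_def D.coh_class_eq_iff coboundaries_def)
    then show ?thesis
      using f by (auto simp: A.carrier_cohomology cocycles_def)
  qed
  show ?thesis
    using ker im d.map_cocycles
    by (auto simp: kernel_def A.carrier_cohomology D.carrier_cohomology T.one_cohomology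
        i.induced_coh_class connecting_coh_class D.cocycles_scale)
qed

end

section \<open>The Hochschild complex of a bimodule\<close>

lemma signed_zero [simp]: "signed i 0 = 0"
  by (simp add: signed_def)

lemma signed_add: "signed i (v + w) = signed i v + signed i w"
  by (simp add: signed_def)

lemma signed_sum: "signed i (sum f S) = (\<Sum>x\<in>S. signed i (f x))"
  by (simp add: signed_def sum_negf)

lemma signed_signed: "signed i (signed j v) = signed (i + j) v"
  by (auto simp: signed_def)

lemma length_contract: "1 \<le> i \<Longrightarrow> i < length xs \<Longrightarrow> length (contract i xs) = length xs - 1"
  by (simp add: contract_def)

lemma contract_append: "i = Suc (length us) \<Longrightarrow> contract i (us @ a # b # vs) = us @ (a * b) # vs"
  by (simp add: contract_def nth_append)

text \<open>Exhibiting the two multiplied entries replaces index arithmetic with \<open>take\<close>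
  and \<open>drop\<close> by list equations.\<close>

lemma split_at_contract:
  assumes "1 \<le> i" "i < length xs"
  obtains us a b vs where "xs = us @ a # b # vs" "i = Suc (length us)"
proof
  show "xs = take (i - 1) xs @ xs ! (i - 1) # xs ! i # drop (i + 1) xs"
    using assms id_take_nth_drop[of "i - 1" xs] Cons_nth_drop_Suc[of i xs] by simp
qed (use assms in simp)

text \<open>Multiplying at \<open>i\<close> moves every later position down by one, hence
  \<open>j - 1\<close>. If the two products share an entry the claim is associativity; otherwise
  they act on disjoint places.\<close>

lemma contract_contract:
  fixes xs :: "'a::semigroup_mult list"
  assumes "1 \<le> i" "i < j" "j < length xs"
  shows "contract i (contract j xs) = contract (j - 1) (contract i xs)"
proof -
  have "1 \<le> j" using assms by simp
  then obtain us c d vs where xs: "xs = us @ c # d # vs" and j: "j = Suc (length us)"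
    using assms(3) by (rule split_at_contract)
  show ?thesis
  \<comment> \<open>Since \<open>j = Suc (length us)\<close>, this is the overlapping case
    \<open>i = j - 1\<close>, where the last entry of \<open>us\<close> is also a factor.\<close>
  proof (cases "i = length us")
    case True
    then obtain us' b where "us = us' @ [b]" "i = Suc (length us')"
      using assms by (cases us rule: rev_cases) auto
    then show ?thesis
      using contract_append[of j us c d vs] contract_append[of i us' b "c * d" vs]
        contract_append[of i us' b c "d # vs"] contract_append[of i us' "b * c" d vs]
      by (simp add: xs j mult.assoc)
  next
    case False
    then have "i < length us" using assms j by simp
    with assms(1) obtain us' a b ws where "us = us' @ a # b # ws" "i = Suc (length us')"
      by (rule split_at_contract)
    then show ?thesis
      using contract_append[of j us c d vs] contract_append[of i us' a b "ws @ (c * d) # vs"]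
        contract_append[of i us' a b "ws @ c # d # vs"]
        contract_append[of "j - 1" "us' @ (a * b) # ws" c d vs]
      by (simp add: xs j)
  qed
qed

section \<open>Faces and the vanishing of the squared coboundary\<close>

definition face :: "('a::ring \<Rightarrow> 'v::ab_group_add \<Rightarrow> 'v) \<Rightarrow> ('v \<Rightarrow> 'a \<Rightarrow> 'v) \<Rightarrow> nat \<Rightarrow>
    ('a list \<Rightarrow> 'v) \<Rightarrow> 'a list \<Rightarrow> 'v"
  where "face l r i f xs =
    (if i = 0 then l (hd xs) (f (tl xs))
     else if i = length xs then r (f (butlast xs)) (last xs)
     else f (contract i xs))"

text \<open>With the two actions treated as outer faces, the coboundary becomes one alternating sum,
  and linearity, the squared coboundary and compatibility with \<open>delta\<close> can all be
  checked face by face.\<close>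

lemma hochschild_eq_sum_face:
  assumes "xs \<noteq> []"
  shows "hochschild l r f xs = (\<Sum>i\<le>length xs. signed i (face l r i f xs))"
proof -
  obtain n where n: "length xs = Suc n" using assms by (cases xs) auto
  have "(\<Sum>i\<le>n. signed i (face l r i f xs)) =
      face l r 0 f xs + (\<Sum>i=1..n. signed i (face l r i f xs))"
    by (simp add: atMost_atLeast0 sum.atLeast_Suc_atMost signed_def)
  also have "(\<Sum>i=1..n. signed i (face l r i f xs)) = (\<Sum>i=1..n. signed i (f (contract i xs)))"
    by (intro sum.cong) (auto simp: face_def n)
  finally show ?thesis
    using assms by (simp add: hochschild_def n face_def)
qed

text \<open>The cancellation behind \<open>d \<circ> d = 0\<close> in any cosimplicial abelian group.\<close>

lemma alternating_double_sum_eq_0: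
  fixes g :: "nat \<Rightarrow> nat \<Rightarrow> 'v::ab_group_add"
  assumes "\<And>i j. i < j \<Longrightarrow> j \<le> Suc m \<Longrightarrow> g j i = g i (j - 1)"
  shows "(\<Sum>j\<le>Suc m. \<Sum>i\<le>m. signed (j + i) (g j i)) = 0"
proof -
  let ?A = "{..Suc m} \<times> {..m}"
  let ?L = "{(j, i) \<in> ?A. i < j}" and ?U = "{(j, i) \<in> ?A. j \<le> i}"
  let ?s = "\<lambda>(j, i). signed (j + i) (g j i)"
  have "sum ?s ?L = (\<Sum>p\<in>?U. - ?s p)"
  \<comment> \<open>The pair \<open>(j, i)\<close> with \<open>i < j\<close> is matched with
    \<open>(i, j - 1)\<close>; the terms agree by assumption and the sums of the indices differ by
    one, so the signs are opposite.\<close>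
  proof (rule sum.reindex_bij_witness[of _ "\<lambda>(i, j). (Suc j, i)" "\<lambda>(j, i). (i, j - 1)"])
    fix p assume "p \<in> ?L"
    then obtain i j where "p = (j, i)" "i < j" "j \<le> Suc m" by auto
    then show "- ?s (case p of (j, i) \<Rightarrow> (i, j - 1)) = ?s p"
      using assms[of i j] by (cases j) (auto simp: signed_def)
  qed auto
  moreover have "sum ?s ?A = sum ?s ?L + sum ?s ?U"
    by (subst sum.union_disjoint[symmetric])
      (auto intro!: sum.cong intro: finite_subset[of _ ?A])
  ultimately show ?thesis
    by (simp add: sum.cartesian_product sum_negf)
qed

lemma Vector_linear_add: "Vector_Spaces.linear s t h \<Longrightarrow> h (x + y) = h x + h y"
  by (simp add: Vector_Spaces.linear_iff)

lemma Vector_linear_scale: "Vector_Spaces.linear s t h \<Longrightarrow> h (s c x) = t c (h x)"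
  by (simp add: Vector_Spaces.linear_iff)

text \<open>The actions are kept arbitrary because the theory is used twice: for the given bimodule
  and for the one with the actions twisted by \<open>lam\<close>.\<close>

locale algebra_bimodule = A: vector_space scaleA + V: vector_space scaleV
  for scaleA :: "'k::field \<Rightarrow> 'a::ring \<Rightarrow> 'a" and scaleV :: "'k \<Rightarrow> 'v::ab_group_add \<Rightarrow> 'v" +
  fixes l :: "'a \<Rightarrow> 'v \<Rightarrow> 'v" and r :: "'v \<Rightarrow> 'a \<Rightarrow> 'v"
  assumes mult_linear_left: "Vector_Spaces.linear scaleA scaleA (\<lambda>x. x * y)"
    and mult_linear_right: "Vector_Spaces.linear scaleA scaleA (\<lambda>y. x * y)"
    and l_linear_left: "Vector_Spaces.linear scaleA scaleV (\<lambda>x. l x v)"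
    and l_linear_right: "Vector_Spaces.linear scaleV scaleV (\<lambda>v. l x v)"
    and r_linear_left: "Vector_Spaces.linear scaleV scaleV (\<lambda>v. r v x)"
    and r_linear_right: "Vector_Spaces.linear scaleA scaleV (\<lambda>x. r v x)"
    and l_mult: "l (x * y) v = l x (l y v)"
    and r_mult: "r v (x * y) = r (r v x) y"
    and l_r: "r (l x v) y = l x (r v y)"
begin

sublocale AV: vector_space_pair scaleA scaleV ..
sublocale VV: vector_space_pair scaleV scaleV ..

abbreviation "cochains \<equiv> multilinear_maps scaleA scaleV"
abbreviation "bd \<equiv> hochschild l r"

lemmas l_simps =
  Vector_linear_add[OF l_linear_right] Vector_linear_scale[OF l_linear_right]
  VV.linear_0[OF l_linear_right] VV.linear_neg[OF l_linear_right] VV.linear_sum[OF l_linear_right]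
lemmas r_simps =
  Vector_linear_add[OF r_linear_left] Vector_linear_scale[OF r_linear_left]
  VV.linear_0[OF r_linear_left] VV.linear_neg[OF r_linear_left] VV.linear_sum[OF r_linear_left]

lemma scale_signed: "scaleV c (signed i v) = signed i (scaleV c v)"
  by (simp add: signed_def)

lemma l_signed: "l x (signed i v) = signed i (l x v)"
  by (simp add: signed_def l_simps)

lemma r_signed: "r (signed i v) x = signed i (r v x)"
  by (simp add: signed_def r_simps)

lemma face_add: "face l r i (f + g) xs = face l r i f xs + face l r i g xs"
  by (simp add: face_def l_simps r_simps)

lemma face_scale: "face l r i (fun_scale scaleV c f) xs = scaleV c (face l r i f xs)"
  by (simp add: face_def l_simps r_simps fun_scale_def)

lemma hochschild_add: "bd (f + g) = bd f + bd g"
proof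
  fix xs show "bd (f + g) xs = (bd f + bd g) xs"
    by (cases "xs = []") (auto simp: hochschild_def[where xs="[]"] hochschild_eq_sum_face face_add signed_add sum.distrib)
qed

lemma hochschild_scale: "bd (fun_scale scaleV c f) = fun_scale scaleV c (bd f)"
proof
  fix xs show "bd (fun_scale scaleV c f) xs = fun_scale scaleV c (bd f) xs"
    by (cases "xs = []") (auto simp: hochschild_def[where xs="[]"] fun_scale_def[of _ _ "bd f"]
        hochschild_eq_sum_face face_scale V.scale_sum_right scale_signed)
qed

text \<open>Each face hands a list with \<open>Suc m\<close> entries to \<open>bd f\<close>, so the
  inner sum has the same range for every \<open>j\<close> and the double sum is over a
  rectangle.\<close>

lemma face_hochschild:
  assumes xs: "length xs = Suc (Suc m)" and j: "j \<le> length xs"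
  shows "face l r j (bd f) xs = (\<Sum>i\<le>Suc m. signed i (face l r j (face l r i f) xs))"
proof -
  have "tl xs \<noteq> []" "butlast xs \<noteq> []" using xs by (auto simp flip: length_0_conv)
  moreover have "j \<noteq> 0 \<Longrightarrow> j \<noteq> length xs \<Longrightarrow> length (contract j xs) = Suc m"
    using xs j by (simp add: length_contract)
  moreover from this have "j \<noteq> 0 \<Longrightarrow> j \<noteq> length xs \<Longrightarrow> contract j xs \<noteq> []" by auto
  ultimately show ?thesis
    using xs j by (auto simp: face_def[of l r j] hochschild_eq_sum_face l_simps r_simps
        l_signed r_signed)
qed

text \<open>This is the cosimplicial identity. Its extreme cases are the three bimodule axioms
  \<open>l_mult\<close>, \<open>l_r\<close> and \<open>r_mult\<close>, and two inner faces commute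
  by \<open>contract_contract\<close>.\<close>

lemma face_face:
  assumes xs: "length xs = Suc (Suc m)" and ij: "i < j" "j \<le> length xs"
  shows "face l r j (face l r i f) xs = face l r i (face l r (j - 1) f) xs"
proof -
  obtain x y zs where xyz: "xs = x # y # zs" using xs by (auto simp: length_Suc_conv)
  obtain us u v where uvw: "xs = us @ [u, v]"
    using xs by (metis append_Cons append_Nil append_assoc length_Suc_conv_rev)
  consider "i = 0" "j = 1" | "i = 0" "1 < j" "j < length xs" | "i = 0" "j = length xs"
    | "0 < i" "j < length xs" | "0 < i" "j = length xs" "i = length xs - 1"
    | "0 < i" "j = length xs" "i < length xs - 1"
    using ij by linarith
  then show ?thesis
  proof cases
    case 1
    then show ?thesis using xyz by (simp add: face_def contract_def l_mult)
  next
    \<comment> \<open>Here, and in the mirror image \<open>6\<close>, one face is an outer action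
      and the other multiplies entries it does not touch; only the indexing shifts.\<close>
    case 2
    then obtain j' where j': "j = Suc (Suc j')"
      using less_imp_Suc_add[of 1 j] by auto
    then have "contract j xs = x # contract (j - 1) (tl xs)"
      using xyz by (simp add: contract_def)
    then show ?thesis using 2 xyz j' by (simp add: face_def)
  next
    case 3
    then show ?thesis using xyz by (simp add: face_def l_r)
  next
    case 4
    then have "contract i (contract j xs) = contract (j - 1) (contract i xs)"
      and "length (contract i xs) = length xs - 1" "length (contract j xs) = length xs - 1"
      using ij by (simp_all only: contract_contract length_contract Suc_le_eq One_nat_def)
    moreover have "i \<noteq> length xs - 1" "j - 1 \<noteq> length xs - 1" "j - 1 \<noteq> 0"
      using 4 ij by linarith+
    ultimately show ?thesis using 4 ij by (simp add: face_def)
  next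
    case 5
    then have "contract i xs = us @ [u * v]"
      using uvw by (simp add: contract_append)
    then show ?thesis using 5 uvw by (simp add: face_def r_mult butlast_append)
  next
    case 6
    then have "1 \<le> i" "i < length (butlast xs)" by simp_all
    then obtain us' a b vs' where us': "butlast xs = us' @ a # b # vs'" and k: "i = Suc (length us')"
      by (rule split_at_contract)
    have "xs = butlast xs @ [last xs]" by (simp add: uvw butlast_append)
    then have "xs = us' @ a # b # (vs' @ [last xs])" unfolding us' by simp
    then have "contract i xs = us' @ (a * b) # vs' @ [last xs]"
      using k by (metis contract_append)
    moreover have "contract i (butlast xs) = us' @ (a * b) # vs'"
      unfolding us' by (rule contract_append[OF k])
    ultimately have "contract i xs = contract i (butlast xs) @ [last xs]" by simp
    then show ?thesis using 6 uvw by (simp add: face_def length_contract butlast_append)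
  qed
qed

lemma hochschild_hochschild: "bd (bd f) = 0"
proof
  fix xs :: "'a list"
  \<comment> \<open>On lists with fewer than two entries the result is zero because
    \<open>bd f []\<close> is zero by convention.\<close>
  consider "xs = []" | x where "xs = [x]" | m where "length xs = Suc (Suc m)"
    by (cases xs; cases "tl xs") auto
  then show "bd (bd f) xs = 0 xs"
  proof cases
    case 3
    then have "xs \<noteq> []" by auto
    then have "bd (bd f) xs = (\<Sum>j\<le>Suc (Suc m). \<Sum>i\<le>Suc m.
        signed (j + i) (face l r j (face l r i f) xs))"
      using 3 by (simp add: hochschild_eq_sum_face[of xs] face_hochschild signed_sum signed_signed
          del: sum.atMost_Suc)
    also have "\<dots> = 0"
      using 3 by (intro alternating_double_sum_eq_0 face_face) auto
    finally show ?thesis by simp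
  qed (auto simp: hochschild_def l_simps r_simps)
qed

lemma linear_signed: "Vector_Spaces.linear scaleA scaleV h \<Longrightarrow>
    Vector_Spaces.linear scaleA scaleV (\<lambda>x. signed i (h x))"
  by (cases "even i") (simp_all add: signed_def AV.linear_compose_neg)

lemma multilinear_mapsD:
  assumes "f \<in> cochains n"
  shows "int (length xs) \<noteq> n \<Longrightarrow> f xs = 0"
    and "Vector_Spaces.linear scaleA scaleV (\<lambda>x. f (xs @ x # ys))"
  using assms by (auto simp: multilinear_maps_def)

text \<open>The varying entry is either an acting element, a factor of a product, or an entry passed
  on to \<open>f\<close>. Each role is linear, by bilinearity of the actions, of the product, or by
  multilinearity of \<open>f\<close>.\<close>

lemma linear_face:
  assumes f: "f \<in> cochains n"
  shows "Vector_Spaces.linear scaleA scaleV (\<lambda>x. face l r i f (us @ x # vs))"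
proof -
  note comp = Vector_Spaces.linear_compose[unfolded o_def]
  let ?k = "length us"
  note lin = multilinear_mapsD(2)[OF f]
  have lin': "Vector_Spaces.linear scaleA scaleV (\<lambda>x. f (xs @ h x # ys))"
    if "Vector_Spaces.linear scaleA scaleA h" for h xs ys
    by (rule comp[OF that lin])
  consider "i = 0" "us = []" | u us' where "i = 0" "us = u # us'"
    | "i \<noteq> 0" "i = Suc (?k + length vs)" "vs = []"
    | vs' v where "i \<noteq> 0" "i = Suc (?k + length vs)" "vs = vs' @ [v]"
    | "i \<noteq> 0" "i \<noteq> Suc (?k + length vs)"
    by (metis neq_Nil_conv rev_exhaust)
  then show ?thesis
  proof cases
    case 1
    then show ?thesis by (simp add: face_def l_linear_left)
  next
    case 2
    then show ?thesis using comp[OF lin l_linear_right] by (simp add: face_def)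
  next
    case 3
    then show ?thesis by (simp add: face_def r_linear_right butlast_append)
  next
    case 4
    then show ?thesis using comp[OF lin r_linear_left] by (simp add: face_def butlast_append)
  next
    case 5
    consider "i < ?k" | "i = ?k" | "i = Suc ?k" "vs = []" | v vs' where "i = Suc ?k" "vs = v # vs'"
      | "i > Suc ?k"
      by (metis neq_Nil_conv linorder_neqE_nat not_less_eq)
    then show ?thesis
    proof cases
      case 1
      then have "contract i (us @ x # vs) = contract i us @ x # vs" for x
        by (auto simp: contract_def nth_append)
      then show ?thesis using 5 lin by (simp add: face_def)
    next
      case 2
      then have "contract i (us @ x # vs) = take (i - 1) us @ (us ! (i - 1) * x) # vs" for x
        using 5 by (auto simp: contract_def nth_append)
      then show ?thesis using 5 lin'[OF mult_linear_right] by (simp add: face_def)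
    next
      case 3
      \<comment> \<open>This index would be the last face, which is already excluded.\<close>
      then show ?thesis using 5 by simp
    next
      case 4
      then show ?thesis using 5 lin'[OF mult_linear_left] by (simp add: face_def contract_append)
    next
      case *: 5
      then obtain d where "i = Suc (Suc ?k + d)"
        using less_imp_Suc_add by blast
      then have "contract i (us @ x # vs) = us @ x # contract (i - Suc ?k) vs" for x
        by (simp add: contract_def nth_append numeral_3_eq_3)
      then show ?thesis using 5 lin by (simp add: face_def)
    qed
  qed
qed

lemma hochschild_in:
  assumes f: "f \<in> cochains n"
  shows "bd f \<in> cochains (n + 1)"
proof -
  have "bd f xs = 0" if "int (length xs) \<noteq> n + 1" for xs
  proof (cases "xs = []")
    case False
    \<comment> \<open>Every face evaluates \<open>f\<close> on a list with one entry fewer, so a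
      list of the wrong length gives a value of \<open>f\<close> outside its degree.\<close>
    have "face l r i f xs = 0" if "i \<le> length xs" for i
      using that False \<open>int (length xs) \<noteq> n + 1\<close>
      by (auto simp: face_def multilinear_mapsD(1)[OF f] length_contract l_simps r_simps Suc_le_eq)
    then show ?thesis using False by (simp add: hochschild_eq_sum_face)
  qed (simp add: hochschild_def)
  moreover have "Vector_Spaces.linear scaleA scaleV (\<lambda>x. bd f (us @ x # vs))" for us vs
    by (simp add: hochschild_eq_sum_face del: sum.atMost_Suc)
      (intro AV.linear_compose_sum ballI linear_signed linear_face[OF f])
  ultimately show ?thesis by (simp add: multilinear_maps_def)
qed

lemma cochain_cx_C_Alg: "cochain_cx (C_Alg scaleA scaleV l r)"
proof -
  have "vector_space (fun_scale scaleV :: _ \<Rightarrow> ('a list \<Rightarrow> 'v) \<Rightarrow> _)"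
    by standard (auto simp: fun_scale_def V.scale_right_distrib V.scale_left_distrib)
  then interpret F: vector_space "fun_scale scaleV :: _ \<Rightarrow> ('a list \<Rightarrow> 'v) \<Rightarrow> _" .
  have "F.subspace (cochains n)" for n
    unfolding F.subspace_def
    by (auto simp: multilinear_maps_def fun_scale_def intro!: AV.linear_zero AV.linear_compose_add
        AV.linear_compose_scale_right)
  then show ?thesis
    by unfold_locales (auto simp: C_Alg_def hochschild_in hochschild_add hochschild_scale hochschild_hochschild
       F.scale_right_distrib F.scale_left_distrib)
qed

end

section \<open>Compatibility of the Hochschild coboundary with the differential\<close>

text \<open>This is the sum \<open>P f\<close> of the introduction. Entries already passed are
  absorbed into \<open>f\<close> in their \<open>e\<close>-form, so inductions must let
  \<open>f\<close> vary.\<close>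

fun twisted_sum :: "('a \<Rightarrow> 'a) \<Rightarrow> ('a \<Rightarrow> 'a) \<Rightarrow> ('a list \<Rightarrow> 'v::ab_group_add) \<Rightarrow> 'a list \<Rightarrow> 'v"
  where "twisted_sum d e f [] = 0"
  | "twisted_sum d e f (x # xs) = f (d x # xs) + twisted_sum d e (\<lambda>ys. f (e x # ys)) xs"

lemma twisted_sum_cong:
  assumes "\<And>ys. length ys = length xs \<Longrightarrow> f ys = g ys"
  shows "twisted_sum d e f xs = twisted_sum d e g xs"
  using assms
proof (induction xs arbitrary: f g)
  case (Cons x xs)
  have "twisted_sum d e (\<lambda>ys. f (e x # ys)) xs = twisted_sum d e (\<lambda>ys. g (e x # ys)) xs"
    by (rule Cons.IH) (simp add: Cons.prems)
  then show ?case by (simp add: Cons.prems)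
qed simp

text \<open>If \<open>d\<close> falls in the second block, the whole first block lies before it and
  carries \<open>e\<close>.\<close>

lemma twisted_sum_append:
  "twisted_sum d e f (us @ vs) =
    twisted_sum d e (\<lambda>zs. f (zs @ vs)) us + twisted_sum d e (\<lambda>zs. f (map e us @ zs)) vs"
  by (induction us arbitrary: f) (simp_all add: add.assoc)

lemma twisted_sum_hom:
  assumes "\<And>v w. h (v + w) = h v + h w"
  shows "twisted_sum d e (\<lambda>ys. h (f ys)) xs = h (twisted_sum d e f xs)"
proof -
  have "h 0 = 0" using assms[of 0 0] by simp
  then show ?thesis by (induction xs arbitrary: f) (simp_all add: assms)
qed

lemma twisted_sum_zero: "twisted_sum d e (\<lambda>ys. 0) xs = 0"
  by (induction xs) simp_all

lemma twisted_sum_add: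
  "twisted_sum d e (\<lambda>ys. f ys + g ys) xs = twisted_sum d e f xs + twisted_sum d e g xs"
  by (induction xs arbitrary: f g) (simp_all add: algebra_simps)

lemma twisted_sum_sum:
  "twisted_sum d e (\<lambda>ys. \<Sum>i\<in>S. f i ys) xs = (\<Sum>i\<in>S. twisted_sum d e (f i) xs)"
  by (induction S rule: infinite_finite_induct) (simp_all add: twisted_sum_zero twisted_sum_add)

text \<open>Sort the nonempty sets by whether they contain 0 and by what remains after shifting
  down; an empty remainder leaves only \<open>{0}\<close>. This is the induction step for sums over
  sets of positions of a list \<open>x # xs\<close>.\<close>

lemma Pow_lessThan_Suc:
  "Pow {..<Suc n} - {{}} = insert {0} ((\<lambda>I. insert 0 (Suc ` I)) ` (Pow {..<n} - {{}})
     \<union> image Suc ` (Pow {..<n} - {{}}))" (is "?L = ?R")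
proof
  show "?L \<subseteq> ?R"
  proof
    fix I assume I: "I \<in> ?L"
    define J where "J = {i. Suc i \<in> I}"
    have J: "J \<subseteq> {..<n}" using I by (auto simp: J_def)
    have eq: "I = (if 0 \<in> I then insert 0 (Suc ` J) else Suc ` J)"
      unfolding J_def by (auto simp: image_iff) (metis not0_implies_Suc)+
    show "I \<in> ?R"
    proof (cases "J = {}")
      case True
      then show ?thesis using I eq by (auto split: if_splits)
    next
      case False
      then show ?thesis using J eq by (cases "0 \<in> I") (auto simp: image_iff)
    qed
  qed
qed auto

lemma sum_nonempty_subsets_Suc:
  "(\<Sum>I\<in>Pow {..<Suc n} - {{}}. g I) =
    g {0} + (\<Sum>I\<in>Pow {..<n} - {{}}. g (insert 0 (Suc ` I))) + (\<Sum>I\<in>Pow {..<n} - {{}}. g (Suc ` I))"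
  for g :: "nat set \<Rightarrow> 'v::ab_group_add"
proof -
  let ?W = "Pow {..<n} - {{}}"
  have fin: "finite ?W" by simp
  have inj: "inj_on (\<lambda>I. insert 0 (Suc ` I)) ?W" "inj_on (image Suc) ?W"
    by (auto intro!: inj_onI simp: set_eq_iff image_iff)
  have "(\<Sum>I\<in>Pow {..<Suc n} - {{}}. g I) =
      g {0} + ((\<Sum>I\<in>(\<lambda>I. insert 0 (Suc ` I)) ` ?W. g I) + (\<Sum>I\<in>image Suc ` ?W. g I))"
    unfolding Pow_lessThan_Suc using fin
    by (subst sum.insert; (subst sum.union_disjoint)?) auto
  then show ?thesis by (simp add: sum.reindex[OF inj(1)] sum.reindex[OF inj(2)] add.assoc)
qed

section \<open>The twist and the two bimodule structures\<close>

context differential_bimodule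
begin

definition twist :: "'a \<Rightarrow> 'a"
  where "twist x = x + scaleA lam (dA x)"

sublocale AA: vector_space_pair scaleA scaleA ..

text \<open>Absorbing the term of weight \<open>lam\<close> into the left factor turns
  \<open>dA\<close> into a skew derivation.\<close>

lemma dA_twist: "dA (x * y) = dA x * y + twist x * dA y"
  by (simp add: dA_mult twist_def distrib_right scale_mult_left add.assoc)

text \<open>Expanding the right-hand side, the terms of order \<open>lam\<close> and
  \<open>lam^2\<close> are exactly \<open>lam\<close> times the product rule for
  \<open>dA\<close>.\<close>

lemma twist_mult: "twist (x * y) = twist x * twist y"
  by (simp add: twist_def dA_mult algebra_simps scale_mult_left scale_mult_right
      scale_right_distrib)

lemma twist_linear: "Vector_Spaces.linear scaleA scaleA twist"
  unfolding twist_def[abs_def]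
  by (intro AA.linear_compose_add AA.linear_compose_scale_right dA_linear linear_id[unfolded id_def])

sublocale Alg: algebra_bimodule scaleA scaleV lact ract
proof -
  have "Vector_Spaces.linear scaleA scaleA (\<lambda>x. x * y)"
    and "Vector_Spaces.linear scaleA scaleA (\<lambda>x. y * x)" for y
    by (simp_all add: Vector_Spaces.linear_iff vector_space_axioms distrib_left distrib_right
        scale_mult_left scale_mult_right)
  then show "algebra_bimodule scaleA scaleV lact ract"
    by (intro algebra_bimodule.intro algebra_bimodule_axioms.intro vector_space_axioms
        V.vector_space_axioms)
      (simp_all only: lact_mult ract_mult lact_ract
        lact_linear_left lact_linear_right ract_linear_left ract_linear_right)
qed

lemma vdash_eq: "vdash scaleA lam dA lact x v = lact (twist x) v"
  by (simp add: vdash_def twist_def)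

lemma dashv_eq: "dashv scaleA lam dA ract v x = ract v (twist x)"
  by (simp add: dashv_def twist_def)

lemmas lact_add = Vector_linear_add[OF lact_linear_left] Vector_linear_add[OF lact_linear_right]
  and lact_scale = Vector_linear_scale[OF lact_linear_left] Vector_linear_scale[OF lact_linear_right]
  and ract_add = Vector_linear_add[OF ract_linear_left] Vector_linear_add[OF ract_linear_right]
  and ract_scale = Vector_linear_scale[OF ract_linear_left] Vector_linear_scale[OF ract_linear_right]
  and dV_add = Vector_linear_add[OF dV_linear]
  and dV_scale = Vector_linear_scale[OF dV_linear]

text \<open>The second structure is the first one pulled back along the algebra endomorphism
  \<open>twist\<close>, so it inherits all the axioms.\<close>

sublocale DO: algebra_bimodule scaleA scaleV "vdash scaleA lam dA lact" "dashv scaleA lam dA ract"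
proof -
  note comp = Vector_Spaces.linear_compose[OF twist_linear, unfolded o_def]
  show "algebra_bimodule scaleA scaleV (vdash scaleA lam dA lact) (dashv scaleA lam dA ract)"
    by (intro algebra_bimodule.intro algebra_bimodule_axioms.intro vector_space_axioms
        V.vector_space_axioms)
      (simp_all add: vdash_eq dashv_eq twist_mult lact_mult ract_mult lact_ract
      comp[OF lact_linear_left] comp[OF ract_linear_right]
      lact_linear_right ract_linear_left Alg.mult_linear_left Alg.mult_linear_right)
qed

lemma dV_lact_twist: "dV (lact x v) = lact (dA x) v + lact (twist x) (dV v)"
  by (simp add: dV_lact twist_def lact_add lact_scale add.assoc)

lemma dV_ract_twist: "dV (ract v x) = ract v (dA x) + ract (dV v) (twist x)"
  by (simp add: dV_ract twist_def ract_add ract_scale add.assoc)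

section \<open>Rewriting \<open>delta\<close> as a telescoped sum\<close>

abbreviation "tsum \<equiv> twisted_sum dA twist"
abbreviation "delta \<equiv> delta_map scaleV lam dA dV"

text \<open>Multilinearity without a degree is stable under fixing the first entry, as the list
  inductions require.\<close>

definition separately_linear :: "('a list \<Rightarrow> 'v) \<Rightarrow> bool"
  where "separately_linear f \<longleftrightarrow> (\<forall>us vs. Vector_Spaces.linear scaleA scaleV (\<lambda>x. f (us @ x # vs)))"

lemma separately_linear_Cons:
  assumes "separately_linear f"
  shows "separately_linear (\<lambda>ys. f (x # ys))"
  using assms[unfolded separately_linear_def, rule_format, of "x # us" for us]
  by (simp add: separately_linear_def)

lemma separately_linear_twist:
  assumes "separately_linear f"
  shows "f (twist x # xs) = f (x # xs) + scaleV lam (f (dA x # xs))"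
proof -
  have "Vector_Spaces.linear scaleA scaleV (\<lambda>x. f (x # xs))"
    using assms[unfolded separately_linear_def, rule_format, of "[]" xs] by simp
  then show ?thesis by (simp add: twist_def Vector_Spaces.linear_iff)
qed

text \<open>Expand \<open>twist\<close> one entry at a time, beginning at the right: each expansion
  contributes \<open>lam\<close> times one summand of \<open>tsum\<close>, with the entries to its
  left still twisted.\<close>

lemma map_twist:
  "separately_linear f \<Longrightarrow> f (map twist xs) = f xs + scaleV lam (tsum f xs)"
proof (induction xs arbitrary: f)
  case (Cons x xs)
  then have "f (twist x # map twist xs) =
      f (twist x # xs) + scaleV lam (tsum (\<lambda>ys. f (twist x # ys)) xs)"
    by (intro Cons.IH separately_linear_Cons)
  then show ?case
    by (simp add: separately_linear_twist[OF Cons.prems] V.scale_right_distrib add.assoc)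
qed simp

definition apply_on :: "nat set \<Rightarrow> 'a list \<Rightarrow> 'a list"
  where "apply_on I xs = map (\<lambda>i. if i \<in> I then dA (xs ! i) else xs ! i) [0..<length xs]"

lemma apply_on_Cons:
  "apply_on I (x # xs) = (if 0 \<in> I then dA x else x) # apply_on {i. Suc i \<in> I} xs"
  by (simp add: apply_on_def upt_conv_Cons map_Suc_upt[symmetric] del: upt_Suc)

lemma apply_on_empty [simp]: "apply_on {} xs = xs"
  by (simp add: apply_on_def map_nth)

text \<open>Split by the role of the first entry. The set \<open>{0}\<close> gives the first summand
  of \<open>tsum\<close>; the sets with and without 0 that meet the tail combine, since
  \<open>x\<close> plus \<open>lam\<close> times \<open>dA x\<close> is
  \<open>twist x\<close>.\<close>

lemma subset_sum_eq_tsum: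
  assumes "separately_linear f"
  shows "(\<Sum>I\<in>Pow {..<length xs} - {{}}. scaleV (lam ^ (card I - 1)) (f (apply_on I xs))) = tsum f xs"
  using assms
proof (induction xs arbitrary: f)
  case (Cons x xs)
  let ?W = "Pow {..<length xs} - {{}}"
  let ?S = "\<lambda>f. \<Sum>I\<in>?W. scaleV (lam ^ (card I - 1)) (f (apply_on I xs))"
  \<comment> \<open>The subtraction in the exponent is truncated, so the shift by one relies on
    \<open>I\<close> being nonempty.\<close>
  have power: "lam ^ (card (insert 0 (Suc ` I)) - Suc 0) = lam * lam ^ (card I - Suc 0)"
    if "I \<in> ?W" for I
  proof -
    have "finite I" using that finite_subset by auto
    then have "card (insert 0 (Suc ` I)) = Suc (card I)" "card I \<noteq> 0"
      using that by (auto simp: card_image)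
    then show ?thesis by (cases "card I") simp_all
  qed
  have "(\<Sum>I\<in>?W. scaleV (lam ^ (card (insert 0 (Suc ` I)) - 1))
        (f (apply_on (insert 0 (Suc ` I)) (x # xs)))) = scaleV lam (?S (\<lambda>ys. f (dA x # ys)))"
    unfolding V.scale_sum_right by (intro sum.cong refl) (simp add: apply_on_Cons power image_iff)
  moreover have "(\<Sum>I\<in>?W. scaleV (lam ^ (card (Suc ` I) - 1)) (f (apply_on (Suc ` I) (x # xs))))
      = ?S (\<lambda>ys. f (x # ys))"
    by (intro sum.cong refl) (simp add: apply_on_Cons card_image image_iff)
  moreover have "?S (\<lambda>ys. f (y # ys)) = tsum (\<lambda>ys. f (y # ys)) xs" for y
    by (intro Cons.IH separately_linear_Cons Cons.prems)
  moreover have "tsum (\<lambda>ys. f (twist x # ys)) xs =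
      tsum (\<lambda>ys. f (x # ys)) xs + scaleV lam (tsum (\<lambda>ys. f (dA x # ys)) xs)"
    by (simp add: separately_linear_twist[OF Cons.prems] twisted_sum_add
        twisted_sum_hom[of "scaleV lam"] V.scale_right_distrib)
  ultimately show ?case
    by (simp add: sum_nonempty_subsets_Suc apply_on_Cons)
qed simp

text \<open>The sum over \<open>k\<close> sorts the nonempty sets of positions by cardinality;
  undoing this grouping gives the sum already telescoped.\<close>

lemma delta_eq:
  assumes "f \<in> Alg.cochains n"
  shows "delta f xs = tsum f xs - dV (f xs)"
proof -
  let ?g = "\<lambda>I. scaleV (lam ^ (card I - 1)) (f (apply_on I xs))"
  have card: "card I \<in> {1..length xs}" if "I \<in> Pow {..<length xs} - {{}}" for I
    using that card_mono[of "{..<length xs}" I] finite_subset[of I "{..<length xs}"]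
    by (auto simp: Suc_le_eq card_gt_0_iff)
  have "(\<Sum>k=1..length xs. scaleV (lam ^ (k - 1))
      (\<Sum>I \<in> {I. I \<subseteq> {..<length xs} \<and> card I = k}. f (apply_on I xs))) =
    (\<Sum>k=1..length xs. \<Sum>I | I \<in> Pow {..<length xs} - {{}} \<and> card I = k. ?g I)"
    unfolding V.scale_sum_right by (intro sum.cong refl) auto
  also have "\<dots> = sum ?g (Pow {..<length xs} - {{}})"
    by (intro sum.group finite_atLeastAtMost image_subsetI card) auto
  also have "\<dots> = tsum f xs"
    using assms by (intro subset_sum_eq_tsum) (auto simp: multilinear_maps_def separately_linear_def)
  finally show ?thesis by (simp add: delta_map_def apply_on_def)
qed

lemma linear_twisted_sum:
  assumes "\<And>ys. Vector_Spaces.linear scaleA scaleV (\<lambda>x. g x ys)"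
  shows "Vector_Spaces.linear scaleA scaleV (\<lambda>x. tsum (g x) us)"
  using assms
proof (induction us arbitrary: g)
  case (Cons u us)
  show ?case
    unfolding twisted_sum.simps by (intro Alg.AV.linear_compose_add Cons.prems Cons.IH)
qed (simp add: Alg.AV.linear_zero)

lemma delta_in:
  assumes f: "f \<in> Alg.cochains n"
  shows "delta f \<in> Alg.cochains n"
proof -
  note comp = Vector_Spaces.linear_compose[unfolded o_def]
  note lin = Alg.multilinear_mapsD(2)[OF f]
  have "delta f xs = 0" if "int (length xs) \<noteq> n" for xs
  proof -
    have "tsum f xs = tsum (\<lambda>ys. 0) xs"
      using that by (intro twisted_sum_cong) (simp add: Alg.multilinear_mapsD(1)[OF f])
    then show ?thesis
      using that dV_add[of 0 0]
      by (simp add: delta_eq[OF f] twisted_sum_zero Alg.multilinear_mapsD(1)[OF f])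
  qed
  moreover have "Vector_Spaces.linear scaleA scaleV (\<lambda>x. delta f (us @ x # vs))" for us vs
    \<comment> \<open>Splitting the list at the varying entry leaves it plain, as
      \<open>dA x\<close> or as \<open>twist x\<close>, according to whether \<open>dA\<close> is
      applied before, at or after its position.\<close>
    unfolding delta_eq[OF f] twisted_sum_append twisted_sum.simps
    by (intro Alg.AV.linear_compose_sub Alg.AV.linear_compose_add linear_twisted_sum comp[OF _ dV_linear]
        comp[OF dA_linear lin] comp[OF twist_linear lin] lin)
  ultimately show ?thesis by (simp add: multilinear_maps_def)
qed

section \<open>Commutation of \<open>delta\<close> with the faces\<close>

text \<open>When \<open>dA\<close> hits the product, \<open>dA_twist\<close> yields precisely the
  two summands in which it hits one of the factors; when it hits a later entry,
  \<open>twist_mult\<close> identifies the twisted products.\<close>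

lemma twisted_sum_contract:
  assumes i: "1 \<le> i" "i < length xs" and f: "separately_linear f"
  shows "tsum (\<lambda>ys. f (contract i ys)) xs = tsum f (contract i xs)"
proof -
  obtain us a b vs where xs: "xs = us @ a # b # vs" and k: "i = Suc (length us)"
    using i by (rule split_at_contract)
  have "f (us @ dA (a * b) # vs) = f (us @ (dA a * b) # vs) + f (us @ (twist a * dA b) # vs)" for us
    using f unfolding separately_linear_def dA_twist
    by (intro Vector_linear_add[of scaleA scaleV "\<lambda>x. f (us @ x # vs)"]) blast
  moreover have "tsum (\<lambda>zs. f (contract i (zs @ a # b # vs))) us = tsum (\<lambda>zs. f (zs @ (a * b) # vs)) us"
    by (intro twisted_sum_cong) (simp add: contract_append k)
  ultimately show ?thesis
    by (simp add: xs twisted_sum_append contract_append k twist_mult add.assoc)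
qed

text \<open>For both outer faces, the term in which \<open>dA\<close> hits the acting element
  cancels against \<open>dV\<close> of the action, and what remains is the action of the twisted
  element.\<close>

lemma tsum_face:
  assumes f: "f \<in> Alg.cochains n" and i: "i \<le> length xs" and xs: "xs \<noteq> []"
  shows "tsum (face lact ract i f) xs - dV (face lact ract i f xs) =
    face (vdash scaleA lam dA lact) (dashv scaleA lam dA ract) i (delta f) xs"
proof -
  have sl: "separately_linear f"
    using f by (simp add: multilinear_maps_def separately_linear_def)
  note ract_diff = Alg.VV.linear_diff[OF ract_linear_left]
  note lact_diff = Alg.VV.linear_diff[OF lact_linear_right]
  consider x ys where "i = 0" "xs = x # ys"
    | y ys where "i = length xs" "i \<noteq> 0" "xs = ys @ [y]"
    | "1 \<le> i" "i < length xs"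
    using i xs by (metis One_nat_def Suc_leI le_neq_implies_less neq_Nil_conv not_gr_zero rev_exhaust)
  then show ?thesis
  proof cases
    case 1
    then show ?thesis
      by (simp add: face_def vdash_eq delta_eq[OF f] dV_lact_twist lact_diff
          twisted_sum_hom[of "lact (twist x)"] lact_add)
  next
    case 2
    have "tsum (\<lambda>zs. face lact ract i f (zs @ [y])) ys = tsum (\<lambda>zs. ract (f zs) y) ys"
      using 2 by (intro twisted_sum_cong) (simp add: face_def)
    also have "\<dots> = ract (tsum f ys) y"
      by (rule twisted_sum_hom) (rule ract_add)
    \<comment> \<open>With \<open>dA\<close> on the last entry all arguments of \<open>f\<close> are
      twisted; \<open>map_twist\<close> expands this, and the surplus term with \<open>lam\<close>
      completes \<open>y\<close> to \<open>twist y\<close>.\<close>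
    finally have "tsum (face lact ract i f) xs =
        ract (tsum f ys) y + ract (f ys + scaleV lam (tsum f ys)) (dA y)"
      using 2 by (simp add: twisted_sum_append face_def map_twist[OF sl])
    also have "\<dots> = ract (f ys) (dA y) + ract (tsum f ys) (twist y)"
      by (simp add: twist_def ract_add ract_scale)
    finally show ?thesis
      using 2 by (simp add: face_def dashv_eq delta_eq[OF f] dV_ract_twist ract_diff)
  next
    case 3
    have "tsum (face lact ract i f) xs = tsum (\<lambda>ys. f (contract i ys)) xs"
      using 3 by (intro twisted_sum_cong) (simp add: face_def)
    then show ?thesis
      using 3 by (simp add: face_def delta_eq[OF f] twisted_sum_contract sl)
  qed
qed

lemma delta_hochschild:
  assumes f: "f \<in> Alg.cochains n"
  shows "delta (Alg.bd f) = DO.bd (delta f)"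
proof
  fix xs
  note eq = delta_eq[OF Alg.hochschild_in[OF f]]
  show "delta (Alg.bd f) xs = DO.bd (delta f) xs"
  proof (cases "xs = []")
    case True
    then show ?thesis
      using dV_add[of 0 0] by (simp add: eq hochschild_def)
  next
    case False
    \<comment> \<open>The range of the face sum depends on the list, but \<open>tsum\<close>
      evaluates its argument only on lists as long as \<open>xs\<close>, so the bound may be
      fixed.\<close>
    have "tsum (Alg.bd f) xs = tsum (\<lambda>ys. \<Sum>i\<le>length xs. signed i (face lact ract i f ys)) xs"
    proof (rule twisted_sum_cong)
      fix ys :: "'a list" assume ys: "length ys = length xs"
      then have "ys \<noteq> []" using False by auto
      then show "Alg.bd f ys = (\<Sum>i\<le>length xs. signed i (face lact ract i f ys))"
        by (simp add: hochschild_eq_sum_face ys)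
    qed
    also have "\<dots> = (\<Sum>i\<le>length xs. signed i (tsum (face lact ract i f) xs))"
      by (simp add: twisted_sum_sum twisted_sum_hom[of "signed _"] signed_add)
    finally have "tsum (Alg.bd f) xs = (\<Sum>i\<le>length xs. signed i (tsum (face lact ract i f) xs))" .
    moreover have "dV (signed i v) = signed i (dV v)" for i v
      using Alg.VV.linear_neg[OF dV_linear] by (simp add: signed_def)
    then have "dV (Alg.bd f xs) = (\<Sum>i\<le>length xs. signed i (dV (face lact ract i f xs)))"
      using False by (simp add: hochschild_eq_sum_face Alg.VV.linear_sum[OF dV_linear])
    moreover have "signed i v - signed i w = signed i (v - w)" for i and v w :: 'v
      by (simp add: signed_def)
    ultimately show ?thesis
      using False by (simp add: eq hochschild_eq_sum_face tsum_face[OF f] flip: sum_subtractf)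
  qed
qed

lemma cochain_map_delta:
  "cochain_map (C_Alg scaleA scaleV lact ract) (C_DO scaleA lam dA scaleV lact ract) delta"
proof -
  interpret A: cochain_cx "C_Alg scaleA scaleV lact ract" by (rule Alg.cochain_cx_C_Alg)
  interpret D: cochain_cx "C_DO scaleA lam dA scaleV lact ract"
    unfolding C_DO_def by (rule DO.cochain_cx_C_Alg)
  have "delta (f + g) = delta f + delta g" "delta (fun_scale scaleV c f) = fun_scale scaleV c (delta f)"
    if f: "f \<in> Alg.cochains n" and g: "g \<in> Alg.cochains n" for f g n c
  proof -
    \<comment> \<open>The formula \<open>delta_eq\<close> holds for cochains only, so the sum and
      the multiple must first be known to be cochains.\<close>
    have fg: "f + g \<in> Alg.cochains n" and cf: "fun_scale scaleV c f \<in> Alg.cochains n"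
      using A.cochain_add[of f n g] A.cochain_scale[of f n c] f g by (auto simp: C_Alg_def)
    have "tsum (f + g) xs = tsum f xs + tsum g xs" for xs
      unfolding plus_fun_def by (rule twisted_sum_add)
    then show "delta (f + g) = delta f + delta g"
      by (intro ext) (simp add: delta_eq[OF f] delta_eq[OF g] delta_eq[OF fg] dV_add)
    have "tsum (fun_scale scaleV c f) xs = scaleV c (tsum f xs)" for xs
      unfolding fun_scale_def by (rule twisted_sum_hom) (rule V.scale_right_distrib)
    moreover have "fun_scale scaleV c g xs = scaleV c (g xs)" for g and xs :: "'a list"
      by (simp add: fun_scale_def)
    ultimately show "delta (fun_scale scaleV c f) = fun_scale scaleV c (delta f)"
      by (intro ext) (simp add: delta_eq[OF cf] delta_eq[OF f] dV_scale V.scale_right_diff_distrib)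
  qed
  then show ?thesis
    by unfold_locales (auto simp: C_DO_def C_Alg_def delta_in delta_hochschild)
qed

end

section \<open>The long exact sequence for differential algebras\<close>

lemma C_DA_eq_mapping_cone:
  "C_DA scaleA lam dA scaleV lact ract dV =
    mapping_cone (C_Alg scaleA scaleV lact ract) (C_DO scaleA lam dA scaleV lact ract)
      (delta_map scaleV lam dA dV)"
  by (simp add: C_DA_def mapping_cone_def Let_def)

theorem theorem3p8:
  fixes scaleA :: "'k::field_char_0 \<Rightarrow> 'a::ring \<Rightarrow> 'a"
    and lam :: 'k
    and dA :: "'a \<Rightarrow> 'a"
    and scaleV :: "'k \<Rightarrow> 'v::ab_group_add \<Rightarrow> 'v"
    and lact :: "'a \<Rightarrow> 'v \<Rightarrow> 'v"
    and ract :: "'v \<Rightarrow> 'a \<Rightarrow> 'v"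
    and dV :: "'v \<Rightarrow> 'v"
  assumes "differential_algebra scaleA lam dA"
    and "differential_bimodule scaleA lam dA scaleV lact ract dV"
  shows
    "let A = C_Alg scaleA scaleV lact ract;
         D = C_DO scaleA lam dA scaleV lact ract;
         T = C_DA scaleA lam dA scaleV lact ract dV;
         delta = delta_map scaleV lam dA dV;
         iota_bar = (\<lambda>n. induced T n (\<lambda>g. (0, g)));
         pi_bar = (\<lambda>n. induced A n fst);
         delta_bar = (\<lambda>n. induced D n delta);
         conn = (\<lambda>n X. coh_scale D n ((- 1) powi n) (delta_bar n X))
     in \<forall>n::int.
       (\<forall>g \<in> cocycles D (n - 1). (0, g) \<in> cocycles T n \<and>
          iota_bar n (coh_class D (n - 1) g) = coh_class T n (0, g)) \<and>
       (\<forall>f g. (f, g) \<in> cocycles T n \<longrightarrow> f \<in> cocycles A n \<and>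
          pi_bar n (coh_class T n (f, g)) = coh_class A n f) \<and>
       (\<forall>f \<in> cocycles A n. delta f \<in> cocycles D n \<and>
          delta_bar n (coh_class A n f) = coh_class D n (delta f)) \<and>
       coh_linear D (n - 1) T n (iota_bar n) \<and>
       coh_linear T n A n (pi_bar n) \<and>
       coh_linear A n D n (conn n) \<and>
       iota_bar n ` carrier (cohomology D (n - 1)) =
         kernel (cohomology T n) (cohomology A n) (pi_bar n) \<and>
       pi_bar n ` carrier (cohomology T n) =
         kernel (cohomology A n) (cohomology D n) (conn n) \<and>
       conn n ` carrier (cohomology A n) =
         kernel (cohomology D n) (cohomology T (n + 1)) (iota_bar (n + 1))"
proof -
  interpret differential_bimodule scaleA lam dA scaleV lact ract dV by (rule assms(2))
  let ?A = "C_Alg scaleA scaleV lact ract" and ?D = "C_DO scaleA lam dA scaleV lact ract"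
  interpret L: cochain_map ?A ?D delta by (rule cochain_map_delta)
  \<comment> \<open>This identifies the connecting map of the statement, sign included, with that of
    the cone.\<close>
  have conn: "(\<lambda>X. coh_scale ?D n ((- 1) powi n) (induced ?D n delta X)) = L.connecting n" for n
    by (rule ext) (simp add: L.connecting_def)
  show ?thesis
    unfolding Let_def C_DA_eq_mapping_cone conn
  proof (intro allI conjI)
    fix n
    interpret i: coh_map ?D "n - 1" L.T n "\<lambda>g. (0, g)" by (rule L.coh_map_inclusion)
    interpret p: coh_map L.T n ?A n fst by (rule L.coh_map_projection)
    interpret d: coh_map ?A n ?D n delta by (rule L.coh_map_delta)
    show "\<forall>g\<in>cocycles ?D (n - 1). (0, g) \<in> cocycles L.T n \<and>
        induced L.T n (\<lambda>g. (0, g)) (coh_class ?D (n - 1) g) = coh_class L.T n (0, g)"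
      by (simp add: i.map_cocycles i.induced_coh_class)
    show "(f, g) \<in> cocycles L.T n \<longrightarrow> f \<in> cocycles ?A n \<and>
        induced ?A n fst (coh_class L.T n (f, g)) = coh_class ?A n f" for f g
      using p.map_cocycles[of "(f, g)"] p.induced_coh_class[of "(f, g)"] by simp
    show "\<forall>f\<in>cocycles ?A n. delta f \<in> cocycles ?D n \<and>
        induced ?D n delta (coh_class ?A n f) = coh_class ?D n (delta f)"
      by (simp add: d.map_cocycles d.induced_coh_class)
    show "coh_linear ?D (n - 1) L.T n (induced L.T n (\<lambda>g. (0, g)))"
      by (rule i.coh_linearI) (rule i.induced_coh_class)
    show "coh_linear L.T n ?A n (induced ?A n fst)"
      by (rule p.coh_linearI) (rule p.induced_coh_class)
  qed (rule L.coh_linear_connecting L.exact_at_cone L.exact_at_source L.exact_at_target)+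
qed

end
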